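(* Let $p$ be an odd prime. For all integers $v$, $k$ and every integer $r\ge 1$, $$H_{r-1}(v+kp^{r})\equiv H_{r-1}(v)-k\,v^{p-2}\pmod p.$$
   Context: Let $\varphi$ be Euler's totient function. For an integer $r\ge1$, the Euler quotient $Q_r(u)$ is the unique integer with $0\le Q_r(u)<p^r$ and $Q_r(u)\equiv \frac{u^{\varphi(p^r)}-1}{p^r}\pmod{p^r}$ when $\gcd(u,p)=1$; and $Q_r(u)=0$ when $p\mid u$. One has $Q_r(u)\equiv Q_{r-1}(u)\pmod{p^{r-1}}$ for $r\ge2$. Define $H_0(u)=Q_1(u)$ (the Fermat quotient) and, for $r\ge2$, $H_{r-1}(u)$ as the unique integer with $0\le H_{r-1}(u)<p$ and $H_{r-1}(u)\equiv \frac{Q_r(u)-Q_{r-1}(u)}{p^{r-1}}\pmod p$. Equivalently, $H_{r-1}(u)$ is the highest digit $a_{r-1}(u)$ in the $p$-adic expansion $Q_r(u)=a_0(u)+a_1(u)p+\dots+a_{r-1}(u)p^{r-1}$, $0\le a_j(u)<p$. *)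

theory Defs
  imports "HOL-Number_Theory.Number_Theory"
begin

text \<open>
  Both quotients below are intended for an odd prime \<open>p\<close>; then the integer divisions are exact:
  \<open>p ^ r\<close> divides \<open>u ^ totient (p ^ r) - 1\<close> for \<open>u\<close> coprime to \<open>p\<close>, and \<open>p ^ m\<close> divides
  \<open>Q\<^sub>m\<^sub>+\<^sub>1(u) - Q\<^sub>m(u)\<close> for \<open>m \<ge> 1\<close>. On \<open>int\<close>, reducing with \<open>mod\<close> selects
  the representative in \<open>[0, p ^ r)\<close> (respectively \<open>[0, p)\<close>), also for negative arguments.
\<close>

definition euler_quotient :: "nat \<Rightarrow> nat \<Rightarrow> int \<Rightarrow> int" where
  "euler_quotient p r u =
     (if coprime u (int p)
      then ((u ^ totient (p ^ r) - 1) div int p ^ r) mod int p ^ r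
      else 0)"

text \<open>\<open>euler_digit p m\<close> is the function \<open>H\<^sub>m\<close>, i.e. \<open>H\<^sub>r\<^sub>-\<^sub>1\<close> for \<open>r = m + 1\<close>.\<close>

definition euler_digit :: "nat \<Rightarrow> nat \<Rightarrow> int \<Rightarrow> int" where
  "euler_digit p m u =
     (if m = 0 then euler_quotient p 1 u
      else ((euler_quotient p (m + 1) u - euler_quotient p m u) div int p ^ m) mod int p)"

end

theory Submission
  imports Defs
begin

text \<open>
  Expanding \<open>(v + d)\<^sup>n\<close> to first order for \<open>d = k p\<^sup>r\<close> and \<open>n = \<phi>(p\<^sup>r) = p\<^sup>r\<^sup>-\<^sup>1(p - 1)\<close>
  and dividing by \<open>p\<^sup>r\<close> gives \<open>Q\<^sub>r(v + k p\<^sup>r) \<equiv> Q\<^sub>r(v) - p\<^sup>r\<^sup>-\<^sup>1 k v\<^sup>n\<^sup>-\<^sup>1\<close> modulo \<open>p\<^sup>r\<close>, where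
  \<open>v\<^sup>n\<^sup>-\<^sup>1 \<equiv> v\<^sup>p\<^sup>-\<^sup>2\<close> modulo \<open>p\<close> by Fermat. The same shift of \<open>v\<close> leaves \<open>Q\<^sub>r\<^sub>-\<^sub>1\<close> unchanged, so only the
  top digit of \<open>Q\<^sub>r\<close> moves.
\<close>

text \<open>Writing E_n for the error term, E_(n+1) = (v + d) * E_n + (n + 1) * d^2 * v^n, so
  divisibility by d^2 is inherited. With exponent \<open>Suc n\<close> the derivative has exponent
  \<open>n\<close>, free of truncated subtraction.\<close>

lemma power_add_first_order:
  fixes v d :: "'a :: comm_ring_1"
  shows "d\<^sup>2 dvd (v + d) ^ Suc n - v ^ Suc n - of_nat (Suc n) * d * v ^ n"
proof (induction n)
  case 0
  then show ?case by simp
next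
  case (Suc n)
  have "(v + d) ^ Suc (Suc n) - v ^ Suc (Suc n) - of_nat (Suc (Suc n)) * d * v ^ Suc n
      = (v + d) * ((v + d) ^ Suc n - v ^ Suc n - of_nat (Suc n) * d * v ^ n)
        + d\<^sup>2 * (of_nat (Suc n) * v ^ n)"
    by (simp add: algebra_simps power2_eq_square)
  then show ?case
    using Suc.IH by simp
qed

text \<open>The theorem for naturals is applied to the residue \<open>v mod int p\<close>, which
  also covers negative \<open>v\<close>.\<close>

lemma fermat_int:
  fixes v :: int
  assumes "prime p" and "coprime v (int p)"
  shows "[v ^ (p - 1) = 1] (mod int p)"
proof -
  define w where "w = nat (v mod int p)"
  have p: "p > 0" using assms(1) by (simp add: prime_gt_0_nat)
  then have w: "int w = v mod int p" by (simp add: w_def)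
  have "coprime (int w) (int p)"
    using assms(2) p by (simp add: w coprime_commute)
  then have "[w ^ (p - 1) = 1] (mod p)"
    using assms(1) by (intro fermat_theorem) (auto simp: prime_nat_iff coprime_absorb_right)
  then have "[int w ^ (p - 1) = 1] (mod int p)"
    by (metis cong_int_iff of_nat_1 of_nat_power)
  then show ?thesis
    by (simp add: w cong_def power_mod)
qed

lemma euler_quotient_shift:
  fixes v k :: int
  assumes p: "prime p" and cop: "coprime v (int p)"
  shows "[euler_quotient p (Suc m) (v + k * int p ^ Suc m)
          = euler_quotient p (Suc m) v - int p ^ m * (k * v ^ (p - 2))] (mod int p ^ Suc m)"
proof -
  define P where "P = int p ^ Suc m"
  define n where "n = totient (p ^ Suc m)"
  have p2: "p \<ge> 2" using p by (simp add: prime_ge_2_nat)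
  have P0: "P \<noteq> 0" using p2 by (simp add: P_def)
  have n: "n = p ^ m * (p - 1)"
    unfolding n_def using p by (rule totient_prime_power_Suc)
  have "n > 0" using n p2 by simp
  then obtain n' where n': "n = Suc n'" using gr0_implies_Suc by blast
  have "P\<^sup>2 dvd (k * P)\<^sup>2" by (simp add: power_mult_distrib)
  also have "(k * P)\<^sup>2 dvd (v + k * P) ^ n - v ^ n - int n * (k * P) * v ^ n'"
    unfolding n' by (rule power_add_first_order)
  finally obtain c where c: "(v + k * P) ^ n - v ^ n - int n * (k * P) * v ^ n' = P\<^sup>2 * c" ..
  have "(v + k * P) ^ n - 1 = (v ^ n - 1) + P * (int n * k * v ^ n' + P * c)"
    using c by (simp add: algebra_simps power2_eq_square)
  \<comment> \<open>The numerators differ by a multiple of \<open>P\<close>, so the values of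
    \<open>div P\<close> differ by exactly its cofactor. The second-order remainder leaves only
    \<open>P * c\<close>, which vanishes modulo \<open>P\<close>.\<close>
  then have quot: "((v + k * P) ^ n - 1) div P = (v ^ n - 1) div P + (int n * k * v ^ n' + P * c)"
    by (simp only: div_mult_self2[OF P0])
  \<comment> \<open>Splitting n - 1 = p^m * (p - 1) - 1 this way isolates a multiple of p - 1, which
    Fermat removes, and leaves the exponent p - 2.\<close>
  have "n' = (p - 1) * (p ^ m - 1) + (p - 2)"
  proof -
    obtain q where q: "p ^ m = Suc q" using p2
      by (metis gr0_implies_Suc zero_less_power pos2 less_le_trans)
    obtain s where s: "p = Suc (Suc s)" using p2 by (metis add_2_eq_Suc le_Suc_ex)
    have "Suc n' = Suc q * (p - 1)" using n n' q by simp
    then show ?thesis unfolding q by (simp add: s)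
  qed
  then have "v ^ n' = (v ^ (p - 1)) ^ (p ^ m - 1) * v ^ (p - 2)"
    by (simp add: power_add power_mult)
  also have "[\<dots> = 1 ^ (p ^ m - 1) * v ^ (p - 2)] (mod int p)"
    by (intro cong_mult cong_pow fermat_int p cop cong_refl)
  finally have "[v ^ n' = v ^ (p - 2)] (mod int p)" by simp
  \<comment> \<open>The minus sign of the result comes from p - 1 \<equiv> -1 in \<open>n\<close>.
    The other factor p^m of \<open>n\<close> then lifts the congruence from modulus p to
    p^(m+1).\<close>
  then have "[(int p - 1) * (k * v ^ n') = (0 - 1) * (k * v ^ (p - 2))] (mod int p)"
    by (intro cong_mult cong_diff cong_refl) (simp_all add: cong_def)
  then have "[int p ^ m * ((int p - 1) * (k * v ^ n')) = int p ^ m * ((0 - 1) * (k * v ^ (p - 2)))]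
      (mod int p ^ m * int p)"
    by (rule cong_cmult_leftI)
  moreover have "int n * k * v ^ n' = int p ^ m * ((int p - 1) * (k * v ^ n'))"
    using p2 by (simp add: n of_nat_diff)
  ultimately have lin: "[int n * k * v ^ n' = - (int p ^ m * (k * v ^ (p - 2)))] (mod P)"
    by (simp only: P_def power_Suc2 minus_mult_left[symmetric] diff_0 mult_1 mult_minus_right)
  have cop': "coprime (v + k * P) (int p)"
  proof -
    have "v + k * P = v + (k * int p ^ m) * int p" by (simp add: P_def mult_ac)
    then show ?thesis using cop by (metis coprime_iff_gcd_eq_1 gcd_add_mult add.commute gcd.commute)
  qed
  have Q: "[euler_quotient p (Suc m) x = (x ^ n - 1) div P] (mod P)" if "coprime x (int p)" for x
    using that unfolding euler_quotient_def P_def[symmetric] n_def[symmetric]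
    by (simp add: cong_def)
  have "[euler_quotient p (Suc m) (v + k * P) = (v ^ n - 1) div P + (int n * k * v ^ n' + P * c)] (mod P)"
    using Q[OF cop'] by (simp only: quot)
  also have "[(v ^ n - 1) div P + (int n * k * v ^ n' + P * c)
      = euler_quotient p (Suc m) v + (- (int p ^ m * (k * v ^ (p - 2))) + 0)] (mod P)"
    using Q[OF cop] lin by (intro cong_add) (simp_all add: cong_0_iff cong_sym)
  finally show ?thesis by (simp add: P_def)
qed

text \<open>For positive \<open>m\<close> this is the shift formula one level down with
  \<open>k * int p\<close> for \<open>k\<close>: the correction becomes a multiple of p^m, and
  congruent reduced values are equal. For \<open>m = 0\<close> everything is reduced modulo
  1.\<close>

lemma euler_quotient_periodic:
  fixes v k :: int
  assumes "prime p" and "coprime v (int p)"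
  shows "euler_quotient p m (v + k * int p ^ Suc m) = euler_quotient p m v"
proof (cases m)
  case 0
  then show ?thesis by (simp add: euler_quotient_def)
next
  case (Suc l)
  have "[euler_quotient p m (v + (k * int p) * int p ^ m)
      = euler_quotient p m v - int p ^ l * (k * int p * v ^ (p - 2))] (mod int p ^ m)"
    unfolding Suc using assms by (rule euler_quotient_shift)
  also have "int p ^ l * (k * int p * v ^ (p - 2)) = int p ^ m * (k * v ^ (p - 2))"
    by (simp add: Suc mult_ac)
  finally have "[euler_quotient p m (v + k * int p ^ Suc m) = euler_quotient p m v] (mod int p ^ m)"
    by (simp add: cong_def mult_ac flip: mod_diff_right_eq)
  then show ?thesis
    by (simp add: euler_quotient_def cong_def split: if_splits)
qed

theorem theorem1:
  fixes p r :: nat and v k :: int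
  assumes "prime p" and "odd p" and "r \<ge> 1"
  shows "[euler_digit p (r - 1) (v + k * int p ^ r)
          = euler_digit p (r - 1) v - k * v ^ (p - 2)] (mod int p)"
proof -
  obtain m where r: "r = Suc m" using assms(3) by (cases r) auto
  have p3: "p \<ge> 3" using assms(1,2) by (metis One_nat_def Suc_leI even_numeral
        le_neq_implies_less numeral_2_eq_2 numeral_3_eq_3 prime_ge_2_nat)
  define u where "u = v + k * int p ^ r"
  have u: "u = v + (k * int p ^ m) * int p" by (simp add: u_def r mult_ac)
  show ?thesis
  proof (cases "coprime v (int p)")
    case False
    have "\<not> coprime u (int p)"
      using False unfolding u by (metis coprime_iff_gcd_eq_1 gcd_add_mult add.commute gcd.commute)
    moreover have "int p dvd v"
      using False assms(1) by (metis coprime_commute prime_imp_coprime prime_nat_int_transfer)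
    \<comment> \<open>Oddness enters here: p - 2 is positive, so p divides v^(p-2). For p = 2 this
      power would be 1.\<close>
    then have "int p dvd k * v ^ (p - 2)"
      using p3 by (metis dvd_mult dvd_power dvd_trans zero_less_diff numeral_2_eq_2 numeral_3_eq_3 Suc_le_lessD)
    ultimately show ?thesis
      using False by (simp add: euler_digit_def euler_quotient_def cong_iff_dvd_diff flip: u_def)
  next
    case True
    \<comment> \<open>This merges the two branches of \<open>euler_digit\<close>: at
      \<open>m = 0\<close> nothing is subtracted and p^m = 1.\<close>
    define Q where "Q = (\<lambda>x. euler_quotient p r x - (if m = 0 then 0 else euler_quotient p m x))"
    have H: "[euler_digit p m x = Q x div int p ^ m] (mod int p)" for x
      by (auto simp: Q_def euler_digit_def r cong_def)
    \<comment> \<open>The subtracted lower quotient agrees at \<open>u\<close> and \<open>v\<close>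
      by periodicity, so the difference inherits the shift of the upper one.\<close>
    have "[Q u = Q v - int p ^ m * (k * v ^ (p - 2))] (mod int p ^ Suc m)"
      using cong_diff[OF euler_quotient_shift[OF assms(1) True, of m k] cong_refl,
          of "if m = 0 then 0 else euler_quotient p m v"]
        euler_quotient_periodic[OF assms(1) True, of m k]
      by (cases "m = 0") (simp_all add: Q_def u_def r algebra_simps)
    then obtain c where "Q v - int p ^ m * (k * v ^ (p - 2)) = Q u + int p ^ Suc m * c"
      by (metis cong_iff_lin)
    then have "Q u = Q v + int p ^ m * (- (k * v ^ (p - 2)) - int p * c)"
      by (simp add: algebra_simps)
    \<comment> \<open>The ambiguity \<open>c\<close> modulo p^(m+1) becomes a multiple of p after
      division by p^m.\<close>
    then have "Q u div int p ^ m = Q v div int p ^ m + (- (k * v ^ (p - 2)) - int p * c)"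
      using p3 by simp
    then have "[Q u div int p ^ m = Q v div int p ^ m - k * v ^ (p - 2)] (mod int p)"
      by (simp add: cong_iff_dvd_diff)
    then have "[euler_digit p m u = euler_digit p m v - k * v ^ (p - 2)] (mod int p)"
      using H by (meson cong_diff cong_refl cong_sym cong_trans)
    then show ?thesis by (simp add: r u_def)
  qed
qed

end
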